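(* Let $\widehat{X}$ be a sandpile graph whose sink has no outgoing edges. If $\mathcal{S}(0)=\{\text{sink}\}$, then $G_0=\{0\}$. Otherwise, $G_0$ is equal to the sandpile group of $\mathcal{S}(0)$, viewed as a subgroup of $\mathcal{M}(\widehat{X})$ via the natural inclusion.
   Context: A sandpile graph $\widehat{X}$ is a finite weakly connected directed multigraph (loops and multiple edges allowed) with a distinguished vertex, the sink, reachable by a directed path from every vertex; the set $V$ of non-sink vertices is nonempty, and $X$ is the digraph obtained by deleting the sink (with edge set $E$). A configuration assigns a nonnegative integer number of grains to each non-sink vertex; it is stable if every $v$ holds fewer than $\deg^{+}(v)$ (out-degree) grains. Toppling an unstable vertex sends one grain along each of its out-edges (grains at the sink vanish; the sink never topples); every configuration has a unique stabilization. $\mathcal{M}(\widehat X)$ is the set of stable configurations with $a\oplus b$ = stabilization of $a+b$, a commutative monoid with identity $0$ (the empty configuration); the sandpile group is its minimal ideal (a group, consisting of the recurrent elements, i.e., those accessible from every element, where $a$ is accessible from $b$ if $b\oplus x=a$ for some $x$). For an idempotent $e$, $G_e$ is the unique maximal subgroup of $\mathcal M(\widehat X)$ with identity $e$. The support $\operatorname{supp}(m)$ is the set of vertices holding at least one grain. A cycle is a directed closed path of length $\ge1$ in $X$. For $W\subseteq V$, $\operatorname{cl}(W)$ is the set of $z\in V$ reachable by a directed path (possibly trivial) in $X$ from some $w\in W$. A set $W\subseteq V$ is strongly connected if each of its vertices reaches every other by a path in $X$; a strongly connected component is a maximal such set; it is cyclic if it contains a cycle. A vertex is acyclic if it lies on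 no cycle. For an idempotent $e$, $A(e)$ is the set of acyclic vertices $v\in V$ with $v\notin\operatorname{cl}(\operatorname{supp}(e))$ such that every cyclic strongly connected component reachable from $v$ by a path in $X$ intersects $\operatorname{supp}(e)$. $\mathcal{S}(e)$ is the subgraph of $\widehat X$ induced on $\operatorname{cl}(\operatorname{supp}(e))\cup A(e)\cup\{\text{sink}\}$ (with sink the same sink), whose edges are those of $\widehat X$ with tail in this vertex set. Sandpile configurations on such a subgraph are identified with configurations of $\widehat X$ that vanish outside its non-sink vertices (the natural inclusion), making its sandpile monoid and group subsets of $\mathcal M(\widehat X)$. *)

theory Defs
  imports "HOL-Algebra.Group" "Graph_Theory.Arc_Walk" "Graph_Theory.Digraph_Component"
begin

definition sandpile_graph :: "('v, 'e) pre_digraph \<Rightarrow> 'v \<Rightarrow> bool" where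
  "sandpile_graph G s \<longleftrightarrow>
     fin_digraph G \<and> connected G \<and> s \<in> verts G \<and> verts G - {s} \<noteq> {} \<and>
     (\<forall>v\<in>verts G. v \<rightarrow>\<^sup>*\<^bsub>G\<^esub> s)"

text \<open>A configuration is a function on the whole vertex type that vanishes off the non-sink
  vertices. Hence, for a subgraph with the same sink, the natural inclusion of configurations
  (extension by zero) is the identity on functions.\<close>

definition config :: "('v, 'e) pre_digraph \<Rightarrow> 'v \<Rightarrow> ('v \<Rightarrow> nat) \<Rightarrow> bool" where
  "config G s c \<longleftrightarrow> (\<forall>v. v \<notin> verts G - {s} \<longrightarrow> c v = 0)"

definition stable :: "('v, 'e) pre_digraph \<Rightarrow> 'v \<Rightarrow> ('v \<Rightarrow> nat) \<Rightarrow> bool" where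
  "stable G s c \<longleftrightarrow> config G s c \<and> (\<forall>v\<in>verts G - {s}. c v < out_degree G v)"

definition topple :: "('v, 'e) pre_digraph \<Rightarrow> 'v \<Rightarrow> 'v \<Rightarrow> ('v \<Rightarrow> nat) \<Rightarrow> 'v \<Rightarrow> nat" where
  "topple G s v c = (\<lambda>w. if w \<in> verts G - {s}
     then c w - (if w = v then out_degree G v else 0) + card (out_arcs G v \<inter> in_arcs G w)
     else 0)"

definition topples :: "('v, 'e) pre_digraph \<Rightarrow> 'v \<Rightarrow> ('v \<Rightarrow> nat) \<Rightarrow> ('v \<Rightarrow> nat) \<Rightarrow> bool" where
  "topples G s c c' \<longleftrightarrow> (\<exists>v\<in>verts G - {s}. out_degree G v \<le> c v \<and> c' = topple G s v c)"

definition stabilization :: "('v, 'e) pre_digraph \<Rightarrow> 'v \<Rightarrow> ('v \<Rightarrow> nat) \<Rightarrow> 'v \<Rightarrow> nat" where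
  "stabilization G s c = (THE c'. (topples G s)\<^sup>*\<^sup>* c c' \<and> stable G s c')"

definition sandpile_monoid :: "('v, 'e) pre_digraph \<Rightarrow> 'v \<Rightarrow> ('v \<Rightarrow> nat) monoid" where
  "sandpile_monoid G s =
     \<lparr> carrier = {c. stable G s c},
       monoid.mult = (\<lambda>a b. stabilization G s (\<lambda>v. a v + b v)),
       one = (\<lambda>_. 0) \<rparr>"

definition monoid_ideal :: "('a, 'b) monoid_scheme \<Rightarrow> 'a set \<Rightarrow> bool" where
  "monoid_ideal M I \<longleftrightarrow> I \<noteq> {} \<and> I \<subseteq> carrier M \<and>
     (\<forall>x\<in>I. \<forall>a\<in>carrier M. a \<otimes>\<^bsub>M\<^esub> x \<in> I \<and> x \<otimes>\<^bsub>M\<^esub> a \<in> I)"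

definition minimal_ideal :: "('a, 'b) monoid_scheme \<Rightarrow> 'a set" where
  "minimal_ideal M =
     (THE I. monoid_ideal M I \<and> (\<forall>J. monoid_ideal M J \<and> J \<subseteq> I \<longrightarrow> J = I))"

definition sandpile_group :: "('v, 'e) pre_digraph \<Rightarrow> 'v \<Rightarrow> ('v \<Rightarrow> nat) set" where
  "sandpile_group G s = minimal_ideal (sandpile_monoid G s)"

text \<open>Subgroups of a monoid in the sense of semigroup theory: the identity \<open>e\<close> may be any
  idempotent of \<open>M\<close>.\<close>

definition subgroup_at :: "('a, 'b) monoid_scheme \<Rightarrow> 'a \<Rightarrow> 'a set \<Rightarrow> bool" where
  "subgroup_at M e H \<longleftrightarrow> H \<subseteq> carrier M \<and> group (M\<lparr>carrier := H, one := e\<rparr>)"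

definition maximal_subgroup :: "('a, 'b) monoid_scheme \<Rightarrow> 'a \<Rightarrow> 'a set" where
  "maximal_subgroup M e =
     (THE H. subgroup_at M e H \<and> (\<forall>K. subgroup_at M e K \<and> H \<subseteq> K \<longrightarrow> K = H))"

text \<open>The vertices of a closed walk are exactly the tails of its arcs. A loop is a cycle.\<close>

definition is_cycle :: "('v, 'e) pre_digraph \<Rightarrow> 'e list \<Rightarrow> bool" where
  "is_cycle X p \<longleftrightarrow> p \<noteq> [] \<and> (\<exists>u. pre_digraph.awalk X u p u)"

definition acyclic_vertex :: "('v, 'e) pre_digraph \<Rightarrow> 'v \<Rightarrow> bool" where
  "acyclic_vertex X v \<longleftrightarrow> v \<in> verts X \<and> \<not> (\<exists>p. is_cycle X p \<and> v \<in> tail X ` set p)"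

definition strongly_connected_set :: "('v, 'e) pre_digraph \<Rightarrow> 'v set \<Rightarrow> bool" where
  "strongly_connected_set X W \<longleftrightarrow> W \<subseteq> verts X \<and> (\<forall>u\<in>W. \<forall>v\<in>W. u \<rightarrow>\<^sup>*\<^bsub>X\<^esub> v)"

definition strong_component :: "('v, 'e) pre_digraph \<Rightarrow> 'v set \<Rightarrow> bool" where
  "strong_component X W \<longleftrightarrow> strongly_connected_set X W \<and>
     (\<forall>W'. strongly_connected_set X W' \<and> W \<subseteq> W' \<longrightarrow> W' = W)"

definition cyclic_set :: "('v, 'e) pre_digraph \<Rightarrow> 'v set \<Rightarrow> bool" where
  "cyclic_set X W \<longleftrightarrow> (\<exists>p. is_cycle X p \<and> tail X ` set p \<subseteq> W)"

definition cl :: "('v, 'e) pre_digraph \<Rightarrow> 'v set \<Rightarrow> 'v set" where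
  "cl X W = {z \<in> verts X. \<exists>w\<in>W. w \<rightarrow>\<^sup>*\<^bsub>X\<^esub> z}"

definition supp :: "('v \<Rightarrow> nat) \<Rightarrow> 'v set" where
  "supp m = {v. m v \<ge> 1}"

definition A_set :: "('v, 'e) pre_digraph \<Rightarrow> ('v \<Rightarrow> nat) \<Rightarrow> 'v set" where
  "A_set X e = {v \<in> verts X. acyclic_vertex X v \<and> v \<notin> cl X (supp e) \<and>
     (\<forall>W. strong_component X W \<and> cyclic_set X W \<and> (\<exists>w\<in>W. v \<rightarrow>\<^sup>*\<^bsub>X\<^esub> w) \<longrightarrow> W \<inter> supp e \<noteq> {})}"

definition S_verts :: "('v, 'e) pre_digraph \<Rightarrow> 'v \<Rightarrow> ('v \<Rightarrow> nat) \<Rightarrow> 'v set" where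
  "S_verts G s e =
     (let X = pre_digraph.del_vert G s in cl X (supp e) \<union> A_set X e \<union> {s})"

definition S_graph :: "('v, 'e) pre_digraph \<Rightarrow> 'v \<Rightarrow> ('v \<Rightarrow> nat) \<Rightarrow> ('v, 'e) pre_digraph" where
  "S_graph G s e = G \<restriction> S_verts G s e"

text \<open>If the sink has no outgoing edges, the heads of the edges leaving the vertex set lie in it
  again, so the induced subgraph keeps every edge with tail in the set, and stabilization in the
  subgraph agrees with stabilization in the whole graph.\<close>

lemma S_verts_closed:
  assumes wf: "wf_digraph G" and sink: "out_arcs G s = {}"
    and a: "a \<in> arcs G" "tail G a \<in> S_verts G s e"
  shows "head G a \<in> S_verts G s e"
proof (cases "head G a = s")
  case True
  then show ?thesis by (simp add: S_verts_def Let_def)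
next
  case False
  interpret G: wf_digraph G by (fact wf)
  define X where "X = pre_digraph.del_vert G s"
  interpret X: wf_digraph X unfolding X_def by (rule G.wf_digraph_del_vert)
  let ?t = "tail G a" and ?h = "head G a"
  have t: "?t \<noteq> s" using sink a by (auto simp: out_arcs_def)
  have aX: "a \<in> arcs X" "tail X a = ?t" "head X a = ?h"
    using a t False by (auto simp: X_def G.del_vert_simps)
  then have th: "?t \<rightarrow>\<^bsub>X\<^esub> ?h" by (metis X.dominatesI arc_to_ends_def)
  have hX: "?h \<in> verts X" using th X.adj_in_verts by blast
  have "?t \<in> cl X (supp e) \<union> A_set X e" using a t by (simp add: S_verts_def X_def Let_def)
  then have "?h \<in> cl X (supp e) \<union> A_set X e"
  proof
    assume "?t \<in> cl X (supp e)"
    then show ?thesis using th hX by (auto simp: cl_def intro: X.reachable_adj_trans)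
  next
    assume A: "?t \<in> A_set X e"
    have reach: "W \<inter> supp e \<noteq> {}"
      if "strong_component X W" "cyclic_set X W" "w \<in> W" "?h \<rightarrow>\<^sup>*\<^bsub>X\<^esub> w" for W w
      using A that th X.adj_reachable_trans[of ?t ?h w] unfolding A_set_def by blast
    show ?thesis
    proof (cases "acyclic_vertex X ?h")
      case True
      then show ?thesis using reach hX by (auto simp: A_set_def)
    next
      case False
      then obtain p where p: "is_cycle X p" "?h \<in> tail X ` set p"
        using hX by (auto simp: acyclic_vertex_def)
      then obtain u where u: "X.awalk u p u" by (auto simp: is_cycle_def)
      define W where "W = {v. ?h \<rightarrow>\<^sup>*\<^bsub>X\<^esub> v \<and> v \<rightarrow>\<^sup>*\<^bsub>X\<^esub> ?h}"
      have hW: "?h \<in> W" using hX by (simp add: W_def)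
      have "strongly_connected_set X W"
        unfolding strongly_connected_set_def W_def
        using X.reachable_trans X.reachable_in_verts(2) by blast
      moreover have "W' = W" if "strongly_connected_set X W'" "W \<subseteq> W'" for W'
        using that hW unfolding strongly_connected_set_def W_def by blast
      ultimately have "strong_component X W" unfolding strong_component_def by blast
      moreover have "cyclic_set X W"
      proof -
        have vs: "w \<in> set (X.awalk_verts u p)" if "w \<in> tail X ` set p" for w
          using that by (auto simp: X.awalk_verts_conv)
        have "w \<rightarrow>\<^sup>*\<^bsub>X\<^esub> w'" if "w \<in> tail X ` set p" "w' \<in> tail X ` set p" for w w'
          using X.awalk_verts_reachable_to[OF u vs[OF that(1)]]
            X.awalk_verts_reachable_from[OF u vs[OF that(2)]] X.reachable_trans by blast
        then have "tail X ` set p \<subseteq> W" using p(2) unfolding W_def by blast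
        then show ?thesis using p(1) unfolding cyclic_set_def by blast
      qed
      ultimately obtain v where v: "v \<in> W" "v \<in> supp e" using reach hW W_def by blast
      then show ?thesis using hX by (auto simp: cl_def W_def)
    qed
  qed
  then show ?thesis by (simp add: S_verts_def X_def Let_def)
qed

lemma arcs_S_graph:
  assumes "wf_digraph G" "out_arcs G s = {}"
  shows "arcs (S_graph G s e) = {a \<in> arcs G. tail G a \<in> S_verts G s e}"
  using S_verts_closed[OF assms] by (auto simp: S_graph_def)

lemma S_verts_subset: "s \<in> verts G \<Longrightarrow> S_verts G s e \<subseteq> verts G"
  by (auto simp: S_verts_def Let_def cl_def A_set_def pre_digraph.del_vert_def)

lemma config_topple: "config G s (topple G s v c)"
  by (auto simp: config_def topple_def)

lemma out_degree_pos:
  assumes "sandpile_graph G s" "v \<in> verts G - {s}"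
  shows "0 < out_degree G v"
proof -
  interpret fin_digraph G using assms by (simp add: sandpile_graph_def)
  have "v \<rightarrow>\<^sup>*\<^bsub>G\<^esub> s" "v \<noteq> s" using assms by (auto simp: sandpile_graph_def)
  then obtain w where "v \<rightarrow>\<^bsub>G\<^esub> w" by (blast elim: converse_reachable_cases)
  then obtain a where "a \<in> out_arcs G v" by auto
  then show ?thesis unfolding out_degree_def using finite_out_arcs by (auto simp: card_gt_0_iff)
qed

lemma stabilization_S_graph:
  assumes G: "sandpile_graph G s" and sink: "out_arcs G s = {}" and c: "config (S_graph G s e) s c"
  shows "stabilization (S_graph G s e) s c = stabilization G s c"
proof -
  interpret fin_digraph G using G by (simp add: sandpile_graph_def)
  let ?S = "S_graph G s e"
  have sG: "s \<in> verts G" using G by (simp add: sandpile_graph_def)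
  have vS: "verts ?S \<subseteq> verts G" using S_verts_subset[OF sG] by (simp add: S_graph_def)
  have th: "tail ?S = tail G" "head ?S = head G" by (simp_all add: S_graph_def)
  have arcs: "arcs ?S = {a \<in> arcs G. tail G a \<in> verts ?S}"
    using arcs_S_graph[OF wf_digraph sink] by (simp add: S_graph_def)
  have closed: "head G a \<in> verts ?S" if "a \<in> arcs G" "tail G a \<in> verts ?S" for a
    using S_verts_closed[OF wf_digraph sink] that by (simp add: S_graph_def)
  have out: "out_arcs ?S v = out_arcs G v" if "v \<in> verts ?S" for v
    using that th arcs by (auto simp: out_arcs_def)
  have deg: "out_degree ?S v = out_degree G v" if "v \<in> verts ?S" for v
    using out[OF that] by (simp add: out_degree_def)
  have btw: "out_arcs ?S v \<inter> in_arcs ?S w = out_arcs G v \<inter> in_arcs G w" if "v \<in> verts ?S" for v w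
    using that th arcs by (auto simp: out_arcs_def in_arcs_def)
  have top: "topple ?S s v d = topple G s v d" if "v \<in> verts ?S" "config ?S s d" for v d
  proof
    fix w
    show "topple ?S s v d w = topple G s v d w"
    proof (cases "w \<in> verts ?S - {s}")
      case True
      then show ?thesis using vS that(1) deg btw by (auto simp: topple_def)
    next
      case False
      have "out_arcs G v \<inter> in_arcs G w = {}" if "w \<noteq> s"
        using False that closed \<open>v \<in> verts ?S\<close> by auto
      then show ?thesis using False that by (auto simp: topple_def config_def)
    qed
  qed
  have eq: "topples ?S s d d' \<longleftrightarrow> topples G s d d'" if d: "config ?S s d" for d d'
  proof
    assume "topples ?S s d d'"
    then obtain v where v: "v \<in> verts ?S - {s}" "out_degree ?S v \<le> d v" "d' = topple ?S s v d"
      by (auto simp: topples_def)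
    then have "v \<in> verts G - {s}" "out_degree G v \<le> d v" "d' = topple G s v d"
      using vS deg top d by auto
    then show "topples G s d d'" unfolding topples_def by blast
  next
    assume "topples G s d d'"
    then obtain v where v: "v \<in> verts G - {s}" "out_degree G v \<le> d v" "d' = topple G s v d"
      by (auto simp: topples_def)
    then have "d v \<noteq> 0" using out_degree_pos[OF G v(1)] by simp
    then have vs: "v \<in> verts ?S - {s}" using d unfolding config_def by metis
    then have "out_degree ?S v \<le> d v" "d' = topple ?S s v d" using v deg top d by auto
    with vs show "topples ?S s d d'" unfolding topples_def by blast
  qed
  have conf: "config ?S s d'" if "topples ?S s d d'" for d d'
    using that by (auto simp: topples_def config_topple)
  have steps1: "(topples G s)\<^sup>*\<^sup>* c d \<and> config ?S s d" if "(topples ?S s)\<^sup>*\<^sup>* c d" for d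
    using that
  proof induction
    case base
    then show ?case using c by simp
  next
    case (step d d')
    then show ?case using eq[of d d'] conf[of d d'] by (auto intro: rtranclp.rtrancl_into_rtrancl)
  qed
  have steps2: "(topples ?S s)\<^sup>*\<^sup>* c d \<and> config ?S s d" if "(topples G s)\<^sup>*\<^sup>* c d" for d
    using that
  proof induction
    case base
    then show ?case using c by simp
  next
    case (step d d')
    then show ?case using eq[of d d'] conf[of d d'] by (auto intro: rtranclp.rtrancl_into_rtrancl)
  qed
  have stab: "stable ?S s d \<longleftrightarrow> stable G s d" if "config ?S s d" for d
  proof -
    have confG: "config G s d" using that vS by (auto simp: config_def)
    have outside: "d v < out_degree G v" if "v \<in> verts G - {s}" "v \<notin> verts ?S" for v
      using out_degree_pos[OF G that(1)] \<open>config ?S s d\<close> that by (simp add: config_def)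
    have "(\<forall>v\<in>verts ?S - {s}. d v < out_degree ?S v) \<longleftrightarrow>
        (\<forall>v\<in>verts G - {s}. d v < out_degree G v)" (is "?l \<longleftrightarrow> ?r")
    proof
      assume l: ?l
      show ?r
      proof
        fix v assume v: "v \<in> verts G - {s}"
        show "d v < out_degree G v"
        proof (cases "v \<in> verts ?S")
          case True
          then have "d v < out_degree ?S v" using l v by blast
          then show ?thesis using deg[OF True] by simp
        qed (rule outside[OF v])
      qed
    next
      assume r: ?r
      show ?l
      proof
        fix v assume "v \<in> verts ?S - {s}"
        then show "d v < out_degree ?S v" using r vS deg[of v] by auto
      qed
    qed
    then show ?thesis using that confG by (simp add: stable_def)
  qed
  have "((topples ?S s)\<^sup>*\<^sup>* c d \<and> stable ?S s d) = ((topples G s)\<^sup>*\<^sup>* c d \<and> stable G s d)" for d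
    using steps1[of d] steps2[of d] stab[of d] by auto
  then show ?thesis by (simp add: stabilization_def)
qed

end

theory Submission
  imports Defs "HOL-Library.Confluence" "HOL-Library.Function_Algebras"
begin

text \<open>
  The group \<open>G\<^sub>0\<close> consists of the units of the sandpile monoid, and a non-sink vertex lies in
  \<open>\<S>(0)\<close> iff it reaches no cycle. A vertex that does reach a cycle has an out-neighbour of the
  same kind, so toppling never clears the set of these vertices: a unit cannot charge any of them.
  Conversely, a vertex \<open>v\<close> of \<open>\<S>(0)\<close> charged with \<open>deg\<^sup>+(v)\<close> grains topples to a configuration
  on its out-neighbours; by well-founded induction that configuration can be completed to one that
  topples to \<open>0\<close>, hence so can a single grain at \<open>v\<close>. So the units are exactly the stable
  configurations of \<open>\<S>(0)\<close>; these form a group, and a group is its own minimal ideal.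
\<close>

section \<open>Maximal subgroups and minimal ideals\<close>

lemma (in monoid) subgroup_at_Units: "subgroup_at G \<one> (Units G)"
proof -
  have "group (G\<lparr>carrier := Units G, one := \<one>\<rparr>)"
    by (rule groupI) (auto simp: m_assoc Units_closed intro: Units_l_inv Units_inv_Units)
  then show ?thesis by (auto simp: subgroup_at_def)
qed

lemma (in monoid) subgroup_at_one_subset_Units:
  assumes "subgroup_at G \<one> K"
  shows "K \<subseteq> Units G"
proof
  fix x assume x: "x \<in> K"
  interpret K: group "G\<lparr>carrier := K, one := \<one>\<rparr>" using assms by (simp add: subgroup_at_def)
  have "K \<subseteq> carrier G" using assms by (simp add: subgroup_at_def)
  then show "x \<in> Units G" using K.Units_eq x unfolding Units_def by fastforce
qed

lemma (in monoid) maximal_subgroup_one: "maximal_subgroup G \<one> = Units G"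
  unfolding maximal_subgroup_def
  by (rule the_equality) (use subgroup_at_Units subgroup_at_one_subset_Units in blast)+

lemma (in group) monoid_ideal_iff: "monoid_ideal G I \<longleftrightarrow> I = carrier G"
proof
  assume I: "monoid_ideal G I"
  then obtain x where x: "x \<in> I" "x \<in> carrier G" by (auto simp: monoid_ideal_def)
  have "a \<in> I" if a: "a \<in> carrier G" for a
  proof -
    have "(a \<otimes> inv x) \<otimes> x \<in> I" using I x a by (simp add: monoid_ideal_def)
    then show ?thesis using x a by (simp add: m_assoc)
  qed
  then show "I = carrier G" using I by (auto simp: monoid_ideal_def)
qed (auto simp: monoid_ideal_def)

lemma (in group) minimal_ideal_eq_carrier: "minimal_ideal G = carrier G"
  unfolding minimal_ideal_def monoid_ideal_iff by (rule the_equality) auto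

lemma minimal_ideal_cong:
  assumes "carrier M = carrier N"
    and "\<And>a b. a \<in> carrier N \<Longrightarrow> b \<in> carrier N \<Longrightarrow> a \<otimes>\<^bsub>M\<^esub> b = a \<otimes>\<^bsub>N\<^esub> b"
  shows "minimal_ideal M = minimal_ideal N"
proof -
  have "monoid_ideal M I \<longleftrightarrow> monoid_ideal N I" for I
    using assms by (auto simp: monoid_ideal_def subset_iff)
  then show ?thesis by (simp add: minimal_ideal_def)
qed

section \<open>Vertices that reach a cycle\<close>

lemma not_adj_if_out_arcs_empty: "out_arcs G v = {} \<Longrightarrow> \<not> v \<rightarrow>\<^bsub>G\<^esub> w"
  by (auto simp: out_arcs_def arcs_ends_conv)

definition reaches_cycle :: "('v, 'e) pre_digraph \<Rightarrow> 'v \<Rightarrow> bool" where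
  "reaches_cycle G v \<longleftrightarrow> (\<exists>x. v \<rightarrow>\<^sup>*\<^bsub>G\<^esub> x \<and> x \<rightarrow>\<^sup>+\<^bsub>G\<^esub> x)"

context wf_digraph
begin

lemma reaches_cycle_iff_adj: "reaches_cycle G v \<longleftrightarrow> (\<exists>w. v \<rightarrow>\<^bsub>G\<^esub> w \<and> reaches_cycle G w)"
proof
  assume "reaches_cycle G v"
  then obtain x where x: "v \<rightarrow>\<^sup>* x" "x \<rightarrow>\<^sup>+ x" by (auto simp: reaches_cycle_def)
  then have "v \<rightarrow>\<^sup>+ x" by (rule reachable_reachable1_trans)
  then obtain w where "v \<rightarrow>\<^bsub>G\<^esub> w" "(w, x) \<in> (arcs_ends G)\<^sup>*" by (blast dest: tranclD)
  moreover from this have "w \<rightarrow>\<^sup>* x" using adj_in_verts(2) reachable_conv' by blast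
  ultimately show "\<exists>w. v \<rightarrow>\<^bsub>G\<^esub> w \<and> reaches_cycle G w" using x(2) by (auto simp: reaches_cycle_def)
qed (auto simp: reaches_cycle_def intro: adj_reachable_trans)

lemma reaches_cycle_in_verts: "reaches_cycle G v \<Longrightarrow> v \<in> verts G"
  by (auto simp: reaches_cycle_def dest: reachable_in_verts)

lemma reachable1_on_cycle:
  assumes p: "is_cycle G p" and x: "x \<in> tail G ` set p" and y: "y \<in> tail G ` set p"
  shows "x \<rightarrow>\<^sup>+ y"
proof -
  obtain u where u: "awalk u p u" using p by (auto simp: is_cycle_def)
  obtain a where a: "a \<in> set p" "x = tail G a" using x by blast
  then obtain q r where "p = q @ a # r" by (auto simp: in_set_conv_decomp)
  then have "awalk x (a # r) u" using u a by (auto simp: awalk_Cons_iff)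
  then have "x \<rightarrow>\<^sup>+ u" by (rule reachable1_awalkI) simp
  also have "u \<rightarrow>\<^sup>* y"
    using y by (intro awalk_verts_reachable_from[OF u]) (auto simp: awalk_verts_conv)
  finally show ?thesis .
qed

lemma ex_cycle_through:
  assumes "v \<rightarrow>\<^sup>+ v"
  obtains p where "is_cycle G p" "v \<in> tail G ` set p"
proof -
  obtain p where p: "awalk v p v" "p \<noteq> []" using assms unfolding reachable1_awalk by blast
  then have "v = tail G (hd p)" by (cases p) (auto simp: awalk_Cons_iff)
  with p that[of p] show thesis by (auto simp: is_cycle_def)
qed

lemma acyclic_vertex_iff: "acyclic_vertex G v \<longleftrightarrow> v \<in> verts G \<and> \<not> v \<rightarrow>\<^sup>+ v"
  unfolding acyclic_vertex_def by (blast dest: reachable1_on_cycle elim: ex_cycle_through)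

lemma strong_component_mutually_reachable:
  assumes "x \<in> verts G"
  shows "strong_component G {v. x \<rightarrow>\<^sup>* v \<and> v \<rightarrow>\<^sup>* x}" (is "strong_component G ?W")
proof -
  have "strongly_connected_set G ?W"
    by (auto simp: strongly_connected_set_def intro: reachable_trans dest: reachable_in_verts)
  moreover have "W = ?W" if "strongly_connected_set G W" "?W \<subseteq> W" for W
    using that assms by (auto simp: strongly_connected_set_def)
  ultimately show ?thesis by (auto simp: strong_component_def)
qed

lemma A_set_zero: "A_set G (\<lambda>_. 0) = {v \<in> verts G. \<not> reaches_cycle G v}"
proof (intro equalityI subsetI)
  fix v assume v: "v \<in> A_set G (\<lambda>_. 0)"
  have False if x: "v \<rightarrow>\<^sup>* x" "x \<rightarrow>\<^sup>+ x" for x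
  proof -
    let ?W = "{w. x \<rightarrow>\<^sup>* w \<and> w \<rightarrow>\<^sup>* x}"
    obtain p where p: "is_cycle G p" "x \<in> tail G ` set p" using ex_cycle_through[OF x(2)] .
    have "tail G ` set p \<subseteq> ?W" using reachable1_on_cycle[OF p(1)] p(2) by blast
    then have "cyclic_set G ?W" using p(1) by (auto simp: cyclic_set_def)
    moreover have "strong_component G ?W"
      using reachable_in_verts(2)[OF x(1)] by (rule strong_component_mutually_reachable)
    ultimately show False using v x by (auto simp: A_set_def supp_def)
  qed
  then show "v \<in> {v \<in> verts G. \<not> reaches_cycle G v}"
    using v by (auto simp: A_set_def reaches_cycle_def)
next
  fix v assume v: "v \<in> {v \<in> verts G. \<not> reaches_cycle G v}"
  have False if W: "strong_component G W" "cyclic_set G W" "w \<in> W" "v \<rightarrow>\<^sup>* w" for W w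
  proof -
    obtain p where p: "is_cycle G p" "tail G ` set p \<subseteq> W"
      using W(2) by (auto simp: cyclic_set_def)
    define x where "x = tail G (hd p)"
    have x: "x \<in> tail G ` set p" using p(1) by (simp add: is_cycle_def x_def)
    have "x \<in> W" using p(2) x by (rule subsetD)
    then have "w \<rightarrow>\<^sup>* x"
      using W(1,3) unfolding strong_component_def strongly_connected_set_def by blast
    with W(4) have "v \<rightarrow>\<^sup>* x" by (rule reachable_trans)
    moreover have "x \<rightarrow>\<^sup>+ x" using p(1) x x by (rule reachable1_on_cycle)
    ultimately show False using v unfolding reaches_cycle_def by blast
  qed
  then show "v \<in> A_set G (\<lambda>_. 0)"
    using v by (auto simp: A_set_def cl_def supp_def acyclic_vertex_iff reaches_cycle_def)
qed

end

lemma (in fin_digraph) not_reaches_cycle_induct [consumes 1, case_names step]: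
  assumes "\<not> reaches_cycle G v"
    and step: "\<And>v. \<not> reaches_cycle G v \<Longrightarrow> (\<And>w. v \<rightarrow>\<^bsub>G\<^esub> w \<Longrightarrow> P w) \<Longrightarrow> P v"
  shows "P v"
proof -
  define R where "R = {(w, v). v \<rightarrow>\<^bsub>G\<^esub> w \<and> \<not> reaches_cycle G v}"
  have "finite R"
    by (rule finite_subset[of _ "verts G \<times> verts G"]) (auto simp: R_def dest: adj_in_verts)
  moreover have "acyclic R"
  proof (rule acyclicI, intro allI notI)
    fix v assume v: "(v, v) \<in> R\<^sup>+"
    then have "\<not> reaches_cycle G v" by (auto simp: R_def dest: tranclD2)
    have "R \<subseteq> (arcs_ends G)\<inverse>" by (auto simp: R_def)
    then have "(v, v) \<in> ((arcs_ends G)\<inverse>)\<^sup>+" using v trancl_mono by blast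
    then have "v \<rightarrow>\<^sup>+ v" by (simp add: trancl_converse)
    then show False using \<open>\<not> reaches_cycle G v\<close> by (auto simp: reaches_cycle_def)
  qed
  ultimately have "wf R" by (rule finite_acyclic_wf)
  then show ?thesis
    using assms(1)
  proof (induction v)
    case (less v)
    then have "P w" if "v \<rightarrow>\<^bsub>G\<^esub> w" for w
      using that reaches_cycle_iff_adj[of v] by (auto simp: R_def)
    then show ?case using step less.prems by blast
  qed
qed

lemma (in fin_digraph) reaches_cycle_del_vert:
  assumes "out_arcs G s = {}"
  shows "reaches_cycle (del_vert s) v \<longleftrightarrow> reaches_cycle G v"
proof -
  interpret X: fin_digraph "del_vert s" by (rule fin_digraph_del_vert)
  note no_out = not_adj_if_out_arcs_empty[OF assms]
  have adj: "v \<rightarrow>\<^bsub>del_vert s\<^esub> w \<longleftrightarrow> v \<rightarrow>\<^bsub>G\<^esub> w \<and> w \<noteq> s" for v w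
    using no_out by (fastforce simp: arcs_ends_conv del_vert_simps)
  have "\<not> reaches_cycle G v" if "\<not> reaches_cycle (del_vert s) v"
    using that
  proof (induction v rule: X.not_reaches_cycle_induct)
    case (step v)
    then show ?case using reaches_cycle_iff_adj no_out adj by metis
  qed
  moreover have "\<not> reaches_cycle (del_vert s) v" if "\<not> reaches_cycle G v"
    using that
  proof (induction v rule: not_reaches_cycle_induct)
    case (step v)
    then show ?case using X.reaches_cycle_iff_adj adj by metis
  qed
  ultimately show ?thesis by blast
qed

lemma (in fin_digraph) verts_S_graph_zero:
  assumes "s \<in> verts G" "out_arcs G s = {}"
  shows "verts (S_graph G s (\<lambda>_. 0)) = {v \<in> verts G. \<not> reaches_cycle G v}"
proof -
  interpret X: fin_digraph "del_vert s" by (rule fin_digraph_del_vert)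
  have "\<not> reaches_cycle G s"
    using reaches_cycle_iff_adj not_adj_if_out_arcs_empty[OF assms(2)] by blast
  then show ?thesis
    using assms by (auto simp: S_graph_def S_verts_def Let_def cl_def supp_def X.A_set_zero
        reaches_cycle_del_vert verts_del_vert)
qed

section \<open>Grains and arcs\<close>

definition grain :: "'v \<Rightarrow> 'v \<Rightarrow> nat" where
  "grain v = 0(v := 1)"

lemma sum_fun_apply: "(\<Sum>x\<in>A. f x) y = (\<Sum>x\<in>A. f x y)"
  by (induction A rule: infinite_finite_induct) auto

lemma sum_grains:
  assumes "finite (supp c)"
  shows "(\<Sum>v\<in>supp c. \<Sum>i<c v. grain v) = c"
proof
  fix w
  have "(\<Sum>v\<in>supp c. \<Sum>i<c v. grain v) w = (\<Sum>v\<in>supp c. if v = w then c v else 0)"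
    by (auto simp: sum_fun_apply grain_def intro!: sum.cong)
  also have "\<dots> = c w" using assms by (auto simp: supp_def)
  finally show "(\<Sum>v\<in>supp c. \<Sum>i<c v. grain v) w = c w" .
qed

lemma (in fin_digraph) card_arcs_between_pos_iff:
  "0 < card (out_arcs G v \<inter> in_arcs G w) \<longleftrightarrow> v \<rightarrow>\<^bsub>G\<^esub> w"
proof -
  have "finite (out_arcs G v \<inter> in_arcs G w)" using finite_out_arcs by blast
  then show ?thesis by (auto simp: card_gt_0_iff arcs_ends_conv)
qed

lemma (in fin_digraph) sum_card_arcs_between:
  fixes h :: "'a \<Rightarrow> 'c::semiring_1"
  shows "(\<Sum>w\<in>verts G. of_nat (card (out_arcs G v \<inter> in_arcs G w)) * h w) =
    (\<Sum>a\<in>out_arcs G v. h (head G a))"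
proof -
  have "(\<Sum>w\<in>verts G. of_nat (card (out_arcs G v \<inter> in_arcs G w)) * h w) =
      (\<Sum>w\<in>verts G. \<Sum>a\<in>{a \<in> out_arcs G v. head G a = w}. h (head G a))"
    by (rule sum.cong) (auto intro!: arg_cong[of _ _ "\<lambda>A. of_nat (card A) * _"])
  also have "\<dots> = (\<Sum>a\<in>out_arcs G v. h (head G a))"
    by (rule sum.group) auto
  finally show ?thesis .
qed

section \<open>Stabilization\<close>

lemma sandpile_monoid_simps:
  "carrier (sandpile_monoid G s) = {c. stable G s c}"
  "a \<otimes>\<^bsub>sandpile_monoid G s\<^esub> b = stabilization G s (a + b)"
  "\<one>\<^bsub>sandpile_monoid G s\<^esub> = 0"
  by (simp_all add: sandpile_monoid_def plus_fun_def zero_fun_def)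

locale sandpile =
  fixes G :: "('v, 'e) pre_digraph" (structure) and s :: 'v
  assumes sandpile_graph: "sandpile_graph G s"

sublocale sandpile \<subseteq> fin_digraph G
  using sandpile_graph by (simp add: sandpile_graph_def)

context sandpile
begin

lemma sink_in_verts: "s \<in> verts G"
  using sandpile_graph by (simp add: sandpile_graph_def)

lemma out_degree_pos: "v \<in> verts G - {s} \<Longrightarrow> 0 < out_degree G v"
  by (rule Defs.out_degree_pos[OF sandpile_graph])

lemma config_zero: "config G s 0"
  by (simp add: config_def)

lemma config_add: "config G s c \<Longrightarrow> config G s d \<Longrightarrow> config G s (c + d)"
  by (simp add: config_def)

lemma stable_config: "stable G s c \<Longrightarrow> config G s c"
  by (simp add: stable_def)

lemma stable_zero: "stable G s 0"
  using out_degree_pos by (simp add: stable_def config_def)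

lemma stable_iff_not_topples:
  assumes "config G s c"
  shows "stable G s c \<longleftrightarrow> (\<nexists>c'. topples G s c c')"
proof -
  have "(\<exists>c'. topples G s c c') \<longleftrightarrow> (\<exists>v\<in>verts G - {s}. out_degree G v \<le> c v)"
    unfolding topples_def by blast
  then show ?thesis using assms by (simp add: stable_def not_le)
qed

lemma topples_config: "topples G s c c' \<Longrightarrow> config G s c'"
  by (auto simp: topples_def config_topple)

lemma topples_rtranclp_stable:
  assumes "(topples G s)\<^sup>*\<^sup>* c d" "stable G s c"
  shows "d = c"
  using assms(1)
proof (cases rule: converse_rtranclpE)
  case (step c')
  then show ?thesis using assms(2) stable_config stable_iff_not_topples by blast
qed simp

lemma topple_add:
  assumes "out_degree G v \<le> c v" "config G s d"
  shows "topple G s v (c + d) = topple G s v c + d"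
  using assms by (auto simp: fun_eq_iff topple_def config_def)

lemma topple_commute:
  assumes "v \<noteq> w" "out_degree G v \<le> c v" "out_degree G w \<le> c w"
  shows "topple G s w (topple G s v c) = topple G s v (topple G s w c)"
  using assms by (auto simp: fun_eq_iff topple_def)

lemma topples_add: "topples G s c c' \<Longrightarrow> config G s d \<Longrightarrow> topples G s (c + d) (c' + d)"
  unfolding topples_def using topple_add by (metis le_add1 order_trans plus_fun_apply)

lemma topples_rtranclp_add:
  assumes "(topples G s)\<^sup>*\<^sup>* c c'" "config G s d"
  shows "(topples G s)\<^sup>*\<^sup>* (c + d) (c' + d)"
  using assms(1)
proof induction
  case (step b b')
  then show ?case
    using topples_add[OF step(2) assms(2)] by (blast intro: rtranclp.rtrancl_into_rtrancl)
qed simp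

lemma confluentp_topples: "confluentp (topples G s)"
proof (rule strong_confluentp_imp_confluentp, rule strong_confluentpI)
  fix c c1 c2
  assume "topples G s c c1" "topples G s c c2"
  then obtain v w where
    v: "v \<in> verts G - {s}" "out_degree G v \<le> c v" "c1 = topple G s v c" and
    w: "w \<in> verts G - {s}" "out_degree G w \<le> c w" "c2 = topple G s w c"
    by (auto simp: topples_def)
  show "\<exists>u. (topples G s)\<^sup>*\<^sup>* c1 u \<and> (topples G s)\<^sup>=\<^sup>= c2 u"
  proof (cases "v = w")
    case True
    then show ?thesis using v w by auto
  next
    case False
    have "out_degree G w \<le> c1 w" "out_degree G v \<le> c2 v"
      using False v w by (auto simp: topple_def)
    then have "topples G s c1 (topple G s w c1)" "topples G s c2 (topple G s w c1)"
      using v w topple_commute[OF False v(2) w(2)] by (auto simp: topples_def)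
    then show ?thesis by blast
  qed
qed

definition weight :: "('v \<Rightarrow> nat) \<Rightarrow> ('v \<Rightarrow> nat) \<Rightarrow> nat" where
  "weight h c = (\<Sum>w\<in>verts G - {s}. h w * c w)"

definition strictly_subharmonic :: "('v \<Rightarrow> nat) \<Rightarrow> bool" where
  "strictly_subharmonic h \<longleftrightarrow>
    (\<forall>v\<in>verts G - {s}. out_degree G v * h v < (\<Sum>a\<in>out_arcs G v. h (head G a)))"

definition strictly_superharmonic :: "('v \<Rightarrow> nat) \<Rightarrow> bool" where
  "strictly_superharmonic h \<longleftrightarrow>
    (\<forall>v\<in>verts G - {s}. (\<Sum>a\<in>out_arcs G v. h (head G a)) < out_degree G v * h v)"

lemma weight_topple_less:
  assumes h: "strictly_superharmonic h" and v: "v \<in> verts G - {s}" "out_degree G v \<le> c v"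
  shows "weight h (topple G s v c) < weight h c"
proof -
  let ?V = "verts G - {s}" and ?k = "\<lambda>w. card (out_arcs G v \<inter> in_arcs G w)"
  have "topple G s v c w + (if w = v then out_degree G v else 0) = c w + ?k w" if "w \<in> ?V" for w
    using that v(2) by (auto simp: topple_def)
  then have "(\<Sum>w\<in>?V. h w * (topple G s v c w + (if w = v then out_degree G v else 0))) =
      (\<Sum>w\<in>?V. h w * (c w + ?k w))"
    by (intro sum.cong) auto
  moreover have "(\<Sum>w\<in>?V. h w * (if w = v then out_degree G v else 0)) = out_degree G v * h v"
    using v(1) by (simp add: if_distrib sum.delta mult.commute cong: if_cong)
  ultimately have "weight h (topple G s v c) + out_degree G v * h v =
      weight h c + (\<Sum>w\<in>?V. h w * ?k w)"
    by (simp add: weight_def distrib_left sum.distrib)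
  also have "(\<Sum>w\<in>?V. h w * ?k w) \<le> (\<Sum>w\<in>verts G. h w * ?k w)"
    by (rule sum_mono2) auto
  also have "\<dots> = (\<Sum>a\<in>out_arcs G v. h (head G a))"
    using sum_card_arcs_between[of v h] by (simp add: mult.commute)
  also have "\<dots> < out_degree G v * h v"
    using h v(1) by (simp add: strictly_superharmonic_def)
  finally show ?thesis by simp
qed

definition sink_distance :: "'v \<Rightarrow> nat" where
  "sink_distance v = (LEAST n. (v, s) \<in> arcs_ends G ^^ n)"

lemma ex_arc_towards_sink:
  assumes v: "v \<in> verts G - {s}"
  obtains a where "a \<in> out_arcs G v" "sink_distance (head G a) < sink_distance v"
proof -
  have "v \<rightarrow>\<^sup>* s" using v sandpile_graph by (auto simp: sandpile_graph_def)
  then have "\<exists>n. (v, s) \<in> arcs_ends G ^^ n"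
    using reachable_rtranclI rtrancl_imp_relpow by metis
  then have path: "(v, s) \<in> arcs_ends G ^^ sink_distance v"
    unfolding sink_distance_def by (rule LeastI_ex)
  moreover have "sink_distance v \<noteq> 0" using path v by (metis Diff_iff insertI1 relpow_0_E)
  ultimately obtain n w where n: "sink_distance v = Suc n"
    and w: "v \<rightarrow>\<^bsub>G\<^esub> w" "(w, s) \<in> arcs_ends G ^^ n"
    by (metis not0_implies_Suc relpow_Suc_E2)
  have "sink_distance w \<le> n" unfolding sink_distance_def by (rule Least_le) (fact w(2))
  moreover obtain a where "a \<in> out_arcs G v" "head G a = w" using w(1) by auto
  ultimately show thesis using that n by simp
qed

text \<open>
  Some out-neighbour of \<open>v\<close> is closer to the sink than \<open>v\<close>; since \<open>K\<close> exceeds all out-degrees, its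
  term \<open>K\<^bsup>D - d\<^esup>\<close> alone exceeds \<open>deg\<^sup>+(v)\<close> times the value at \<open>v\<close>.
\<close>

lemma ex_strictly_subharmonic:
  obtains g M where "strictly_subharmonic g" "\<forall>v. g v \<le> M"
proof
  define D where "D = Max (sink_distance ` verts G)"
  define K where "K = card (arcs G) + 1"
  define g where "g v = K ^ (D - sink_distance v)" for v
  show "\<forall>v. g v \<le> K ^ D" by (simp add: g_def K_def power_increasing)
  show "strictly_subharmonic g"
    unfolding strictly_subharmonic_def
  proof
    fix v assume v: "v \<in> verts G - {s}"
    obtain a where a: "a \<in> out_arcs G v" "sink_distance (head G a) < sink_distance v"
      using ex_arc_towards_sink[OF v] .
    have "sink_distance v \<le> D" using v by (simp add: D_def)
    then have closer: "Suc (D - sink_distance v) \<le> D - sink_distance (head G a)" using a(2) by simp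
    have "out_degree G v < K"
      using card_mono[OF finite_arcs, of "out_arcs G v"]
      by (simp add: K_def out_degree_def out_arcs_def)
    then have "out_degree G v * g v < K * g v" by (simp add: g_def)
    also have "\<dots> \<le> g (head G a)"
      using power_increasing[OF closer, of K] by (simp add: g_def K_def)
    also have "\<dots> \<le> (\<Sum>a\<in>out_arcs G v. g (head G a))"
      using a(1) finite_out_arcs by (intro member_le_sum) auto
    finally show "out_degree G v * g v < (\<Sum>a\<in>out_arcs G v. g (head G a))" .
  qed
qed

lemma strictly_superharmonic_complement:
  assumes g: "strictly_subharmonic g" and bounded: "\<forall>v. g v \<le> M"
  shows "strictly_superharmonic (\<lambda>v. M - g v)"
  unfolding strictly_superharmonic_def
proof
  fix v assume "v \<in> verts G - {s}"
  then have "out_degree G v * g v < (\<Sum>a\<in>out_arcs G v. g (head G a))"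
    using g by (simp add: strictly_subharmonic_def)
  moreover have "(\<Sum>a\<in>out_arcs G v. M - g (head G a)) + (\<Sum>a\<in>out_arcs G v. g (head G a)) =
      out_degree G v * M"
    using bounded by (simp add: out_degree_def flip: sum.distrib)
  moreover have "out_degree G v * (M - g v) + out_degree G v * g v = out_degree G v * M"
    using bounded by (simp flip: distrib_left)
  ultimately show "(\<Sum>a\<in>out_arcs G v. M - g (head G a)) < out_degree G v * (M - g v)"
    by linarith
qed

lemma wfp_conversep_topples: "wfp (topples G s)\<inverse>\<inverse>"
proof -
  obtain g M where "strictly_subharmonic g" "\<forall>v. g v \<le> M"
    by (rule ex_strictly_subharmonic)
  then have "strictly_superharmonic (\<lambda>v. M - g v)" by (rule strictly_superharmonic_complement)
  then show ?thesis
    by (intro wfp_if_convertible_to_nat[where f = "weight (\<lambda>v. M - g v)"])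
      (auto simp: topples_def intro: weight_topple_less)
qed

lemma ex_stabilization:
  assumes "config G s c"
  shows "\<exists>d. (topples G s)\<^sup>*\<^sup>* c d \<and> stable G s d"
  using wfp_conversep_topples assms
proof (induction c rule: wfp_induct_rule)
  case (less c)
  show ?case
  proof (cases "stable G s c")
    case False
    then obtain c' where topples: "topples G s c c'"
      using stable_iff_not_topples less.prems by blast
    then obtain d where "(topples G s)\<^sup>*\<^sup>* c' d" "stable G s d"
      using less.IH topples_config by blast
    then show ?thesis using topples converse_rtranclp_into_rtranclp[of "topples G s"] by blast
  qed blast
qed

lemma stabilization_eqI:
  assumes "(topples G s)\<^sup>*\<^sup>* c d" "stable G s d"
  shows "stabilization G s c = d"
  unfolding stabilization_def
proof (rule the_equality)
  fix d' assume "(topples G s)\<^sup>*\<^sup>* c d' \<and> stable G s d'"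
  then show "d' = d"
    using confluentpD[OF confluentp_topples assms(1)] assms(2) topples_rtranclp_stable by metis
qed (use assms in simp)

lemma topples_rtranclp_stabilization: "config G s c \<Longrightarrow> (topples G s)\<^sup>*\<^sup>* c (stabilization G s c)"
  and stable_stabilization: "config G s c \<Longrightarrow> stable G s (stabilization G s c)"
  using ex_stabilization[of c] stabilization_eqI[of c] by auto

lemma stabilization_stable: "stable G s c \<Longrightarrow> stabilization G s c = c"
  by (rule stabilization_eqI) auto

lemma stabilization_add_stabilization:
  assumes "config G s c" "config G s d"
  shows "stabilization G s (stabilization G s c + d) = stabilization G s (c + d)"
proof -
  let ?c = "stabilization G s c"
  have "config G s (?c + d)"
    using assms by (intro config_add stable_config[OF stable_stabilization])
  moreover have "(topples G s)\<^sup>*\<^sup>* (c + d) (?c + d)"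
    using assms by (intro topples_rtranclp_add topples_rtranclp_stabilization)
  ultimately have "(topples G s)\<^sup>*\<^sup>* (c + d) (stabilization G s (?c + d))"
    using topples_rtranclp_stabilization by (metis rtranclp_trans)
  then show ?thesis
    using stable_stabilization[OF \<open>config G s (?c + d)\<close>] by (simp add: stabilization_eqI)
qed

lemma comm_monoid_sandpile_monoid: "comm_monoid (sandpile_monoid G s)"
proof (rule comm_monoidI, unfold sandpile_monoid_simps mem_Collect_eq)
  fix a b c
  assume "stable G s a" "stable G s b" "stable G s c"
  then have config: "config G s a" "config G s b" "config G s c" by (simp_all add: stable_config)
  have "stabilization G s (stabilization G s (a + b) + c) = stabilization G s (a + b + c)"
    using config by (intro stabilization_add_stabilization config_add)
  also have "\<dots> = stabilization G s (b + c + a)" by (simp add: ac_simps)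
  also have "\<dots> = stabilization G s (stabilization G s (b + c) + a)"
    using config by (intro stabilization_add_stabilization[symmetric] config_add)
  finally show "stabilization G s (stabilization G s (a + b) + c) =
      stabilization G s (a + stabilization G s (b + c))"
    by (simp add: add.commute)
qed (auto simp: stable_zero stabilization_stable add.commute
    intro: stable_stabilization config_add stable_config)

section \<open>Configurations that can be cleared\<close>

definition clearable :: "('v \<Rightarrow> nat) \<Rightarrow> bool" where
  "clearable c \<longleftrightarrow> config G s c \<and> (\<exists>d. config G s d \<and> (topples G s)\<^sup>*\<^sup>* (c + d) 0)"

lemma clearable_zero: "clearable 0"
  using config_zero by (auto simp: clearable_def intro!: exI[of _ 0])

lemma clearable_add:
  assumes "clearable c" "clearable c'"
  shows "clearable (c + c')"
proof -
  obtain d d' where d: "config G s d" "(topples G s)\<^sup>*\<^sup>* (c + d) 0"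
    and d': "config G s d'" "(topples G s)\<^sup>*\<^sup>* (c' + d') 0"
    using assms by (auto simp: clearable_def)
  have "(topples G s)\<^sup>*\<^sup>* ((c + d) + (c' + d')) (0 + (c' + d'))"
    using assms(2) d d' by (intro topples_rtranclp_add config_add) (auto simp: clearable_def)
  also have "(topples G s)\<^sup>*\<^sup>* (0 + (c' + d')) 0" using d'(2) by simp
  finally have "(topples G s)\<^sup>*\<^sup>* ((c + c') + (d + d')) 0" by (simp add: ac_simps)
  then show ?thesis
    using assms d(1) d'(1) config_add by (auto simp: clearable_def)
qed

lemma clearable_sum: "(\<And>x. x \<in> A \<Longrightarrow> clearable (f x)) \<Longrightarrow> clearable (\<Sum>x\<in>A. f x)"
  by (induction A rule: infinite_finite_induct) (auto simp: clearable_zero clearable_add)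

lemma clearable_mono:
  assumes "clearable c" "c' \<le> c"
  shows "clearable c'"
proof -
  obtain d where d: "config G s d" "(topples G s)\<^sup>*\<^sup>* (c + d) 0"
    using assms(1) by (auto simp: clearable_def)
  define r where "r w = c w - c' w" for w
  have split: "c = c' + r" using assms(2) by (auto simp: r_def le_fun_def)
  then have "config G s c'" "config G s r" using assms(1) by (auto simp: clearable_def config_def)
  moreover have "(topples G s)\<^sup>*\<^sup>* (c' + (r + d)) 0" using d(2) split by (simp add: add.assoc)
  ultimately show ?thesis using d(1) config_add by (auto simp: clearable_def)
qed

lemma clearable_if_topples:
  assumes "config G s c" "topples G s c c'" "clearable c'"
  shows "clearable c"
proof -
  obtain d where d: "config G s d" "(topples G s)\<^sup>*\<^sup>* (c' + d) 0"
    using assms(3) by (auto simp: clearable_def)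
  then have "(topples G s)\<^sup>*\<^sup>* (c + d) 0"
    using topples_add[OF assms(2)] by (intro converse_rtranclp_into_rtranclp[of _ "c + d"])
  then show ?thesis using assms(1) d(1) by (auto simp: clearable_def)
qed

lemma clearable_if_grains:
  assumes "config G s c" "\<And>v. v \<in> supp c \<Longrightarrow> clearable (grain v)"
  shows "clearable c"
proof -
  have "supp c \<subseteq> verts G" using assms(1) by (auto simp: supp_def config_def Suc_le_eq)
  then have "finite (supp c)" using finite_verts finite_subset by blast
  moreover have "clearable (\<Sum>v\<in>supp c. \<Sum>i<c v. grain v)"
    using assms(2) by (intro clearable_sum)
  ultimately show ?thesis by (simp only: sum_grains)
qed

lemma clearable_grain:
  assumes "\<not> reaches_cycle G v" "v \<in> verts G - {s}"
  shows "clearable (grain v)"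
  using assms
proof (induction v rule: not_reaches_cycle_induct)
  case (step v)
  define c where "c = 0(v := out_degree G v)"
  have config: "config G s c" using step.prems by (auto simp: c_def config_def)
  have "clearable (topple G s v c)"
  proof (rule clearable_if_grains)
    fix w assume "w \<in> supp (topple G s v c)"
    then have "w \<in> verts G - {s}" "0 < card (out_arcs G v \<inter> in_arcs G w)"
      by (auto simp: supp_def topple_def c_def split: if_splits)
    then show "clearable (grain w)" using step.IH by (simp add: card_arcs_between_pos_iff)
  qed (rule config_topple)
  moreover have "topples G s c (topple G s v c)"
    using step.prems by (auto simp: topples_def c_def)
  ultimately have "clearable c" by (intro clearable_if_topples[OF config])
  moreover have "grain v \<le> c"
    using out_degree_pos[OF step.prems] by (auto simp: grain_def c_def le_fun_def)
  ultimately show ?case by (rule clearable_mono)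
qed

lemma Units_sandpile_monoid: "Units (sandpile_monoid G s) = {c. stable G s c \<and> clearable c}"
proof (intro equalityI subsetI CollectI conjI)
  fix c assume "c \<in> Units (sandpile_monoid G s)"
  then obtain d where cd: "stable G s c" "stable G s d" "stabilization G s (c + d) = 0"
    by (auto simp: Units_def sandpile_monoid_simps)
  then show "stable G s c" "clearable c"
    using topples_rtranclp_stabilization[of "c + d"] config_add stable_config
    by (auto simp: clearable_def intro!: exI[of _ d])
next
  fix c assume clearable: "c \<in> {c. stable G s c \<and> clearable c}"
  then obtain d where d: "config G s d" "(topples G s)\<^sup>*\<^sup>* (c + d) 0"
    by (auto simp: clearable_def)
  have "stabilization G s (stabilization G s d + c) = stabilization G s (d + c)"
    using clearable by (intro stabilization_add_stabilization[OF d(1)] stable_config) simp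
  also have "\<dots> = 0"
    using stabilization_eqI[OF d(2) stable_zero] by (simp add: add.commute)
  finally show "c \<in> Units (sandpile_monoid G s)"
    using clearable stable_stabilization[OF d(1)] add.commute[of c "stabilization G s d"]
    unfolding Units_def sandpile_monoid_simps by auto
qed

end

section \<open>Absorbing sinks\<close>

locale absorbing_sandpile = sandpile +
  assumes sink_absorbing: "out_arcs G s = {}"
begin

lemma topples_charges_reaching_cycle:
  assumes "topples G s c d" "\<exists>v\<in>supp c. reaches_cycle G v"
  shows "\<exists>w\<in>supp d. reaches_cycle G w"
proof -
  obtain u where u: "u \<in> verts G - {s}" "d = topple G s u c"
    using assms(1) by (auto simp: topples_def)
  obtain v where v: "v \<in> supp c" "reaches_cycle G v" using assms(2) by blast
  have not_sink: "w \<in> verts G - {s}" if "reaches_cycle G w" for w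
    using that reaches_cycle_in_verts reaches_cycle_iff_adj
      not_adj_if_out_arcs_empty[OF sink_absorbing]
    by blast
  show ?thesis
  proof (cases "u = v")
    case False
    then have "v \<in> supp d" using u v not_sink by (auto simp: supp_def topple_def)
    then show ?thesis using v(2) by blast
  next
    case True
    obtain w where w: "v \<rightarrow>\<^bsub>G\<^esub> w" "reaches_cycle G w" using v(2) reaches_cycle_iff_adj by blast
    then have "0 < card (out_arcs G v \<inter> in_arcs G w)" by (simp add: card_arcs_between_pos_iff)
    then have "w \<in> supp d" using True u(2) not_sink[OF w(2)] by (auto simp: supp_def topple_def)
    then show ?thesis using w(2) by blast
  qed
qed

lemma clearable_iff:
  assumes "config G s c"
  shows "clearable c \<longleftrightarrow> (\<forall>v\<in>supp c. \<not> reaches_cycle G v)"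
proof
  assume "clearable c"
  then obtain d where d: "(topples G s)\<^sup>*\<^sup>* (c + d) 0" by (auto simp: clearable_def)
  have charged: "\<exists>w\<in>supp b. reaches_cycle G w"
    if "(topples G s)\<^sup>*\<^sup>* a b" "\<exists>v\<in>supp a. reaches_cycle G v" for a b
    using that by induction (auto intro: topples_charges_reaching_cycle)
  have "\<not> (\<exists>v\<in>supp (c + d). reaches_cycle G v)" using charged[OF d] by (auto simp: supp_def)
  then show "\<forall>v\<in>supp c. \<not> reaches_cycle G v" by (auto simp: supp_def)
next
  assume "\<forall>v\<in>supp c. \<not> reaches_cycle G v"
  moreover have "supp c \<subseteq> verts G - {s}" using assms by (fastforce simp: supp_def config_def)
  ultimately show "clearable c"
    using clearable_grain by (intro clearable_if_grains[OF assms]) blast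
qed

lemma verts_S_graph_subset: "verts (S_graph G s e) \<subseteq> verts G"
  using S_verts_subset[OF sink_in_verts] by (simp add: S_graph_def)

lemma out_degree_S_graph:
  "v \<in> verts (S_graph G s e) \<Longrightarrow> out_degree (S_graph G s e) v = out_degree G v"
  using arcs_S_graph[OF wf_digraph sink_absorbing]
  by (auto simp: out_degree_def out_arcs_def S_graph_def intro!: arg_cong[of _ _ card])

lemma config_S_graph_iff:
  "config (S_graph G s e) s c \<longleftrightarrow> config G s c \<and> supp c \<subseteq> verts (S_graph G s e)"
  using verts_S_graph_subset[of e] by (auto simp: config_def supp_def Suc_le_eq subset_iff)

lemma stable_S_graph_iff:
  "stable (S_graph G s e) s c \<longleftrightarrow> stable G s c \<and> supp c \<subseteq> verts (S_graph G s e)"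
proof -
  have "c v < out_degree G v"
    if "v \<in> verts G - {s}" "v \<notin> verts (S_graph G s e)" "supp c \<subseteq> verts (S_graph G s e)" for v
  proof -
    have "v \<notin> supp c" using that by blast
    then show ?thesis using out_degree_pos[OF that(1)] by (simp add: supp_def)
  qed
  then show ?thesis
    using verts_S_graph_subset[of e]
    by (auto simp: stable_def config_S_graph_iff out_degree_S_graph)
qed

lemma mult_sandpile_monoid_S_graph:
  assumes "a \<in> carrier (sandpile_monoid (S_graph G s e) s)"
    and "b \<in> carrier (sandpile_monoid (S_graph G s e) s)"
  shows "a \<otimes>\<^bsub>sandpile_monoid (S_graph G s e) s\<^esub> b = a \<otimes>\<^bsub>sandpile_monoid G s\<^esub> b"
proof -
  have "config (S_graph G s e) s (a + b)"
    using assms by (simp add: sandpile_monoid_simps stable_def config_def)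
  then show ?thesis
    using stabilization_S_graph[OF sandpile_graph sink_absorbing]
    by (simp add: sandpile_monoid_simps)
qed

lemma carrier_sandpile_monoid_S_graph_zero:
  "carrier (sandpile_monoid (S_graph G s (\<lambda>_. 0)) s) = Units (sandpile_monoid G s)"
proof -
  have "clearable c \<longleftrightarrow> supp c \<subseteq> verts (S_graph G s (\<lambda>_. 0))" if "stable G s c" for c
  proof -
    have "supp c \<subseteq> verts G"
      using stable_config[OF that] by (fastforce simp: supp_def config_def)
    then show ?thesis
      using clearable_iff[OF stable_config[OF that]]
        verts_S_graph_zero[OF sink_in_verts sink_absorbing]
      by auto
  qed
  then show ?thesis
    by (auto simp: Units_sandpile_monoid sandpile_monoid_simps stable_S_graph_iff)
qed

lemma sandpile_group_S_graph_zero: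
  "sandpile_group (S_graph G s (\<lambda>_. 0)) s = Units (sandpile_monoid G s)"
proof -
  let ?M = "sandpile_monoid G s"
  interpret M: comm_monoid ?M by (rule comm_monoid_sandpile_monoid)
  have "sandpile_group (S_graph G s (\<lambda>_. 0)) s = minimal_ideal (units_of ?M)"
    unfolding sandpile_group_def
    by (rule minimal_ideal_cong)
      (simp_all add: units_of_def carrier_sandpile_monoid_S_graph_zero mult_sandpile_monoid_S_graph)
  also have "\<dots> = Units ?M"
    by (simp add: group.minimal_ideal_eq_carrier M.units_group units_of_carrier)
  finally show ?thesis .
qed

end

theorem theorem3p5:
  fixes G :: "('v, 'e) pre_digraph" and s :: 'v
  assumes "sandpile_graph G s" and "out_arcs G s = {}"
  shows "(verts (S_graph G s (\<lambda>_. 0)) = {s} \<longrightarrow>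
            maximal_subgroup (sandpile_monoid G s) (\<lambda>_. 0) = {\<lambda>_. 0}) \<and>
         (verts (S_graph G s (\<lambda>_. 0)) \<noteq> {s} \<longrightarrow>
            maximal_subgroup (sandpile_monoid G s) (\<lambda>_. 0) = sandpile_group (S_graph G s (\<lambda>_. 0)) s)"
proof -
  interpret absorbing_sandpile G s using assms by unfold_locales
  interpret M: comm_monoid "sandpile_monoid G s" by (rule comm_monoid_sandpile_monoid)
  have units: "maximal_subgroup (sandpile_monoid G s) (\<lambda>_. 0) = Units (sandpile_monoid G s)"
    using M.maximal_subgroup_one by (simp add: sandpile_monoid_def)
  have "Units (sandpile_monoid G s) = {\<lambda>_. 0}" if "verts (S_graph G s (\<lambda>_. 0)) = {s}"
  proof -
    have "stable (S_graph G s (\<lambda>_. 0)) s c \<longleftrightarrow> c = (\<lambda>_. 0)" for c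
      using that by (auto simp: stable_def config_def)
    then show ?thesis
      unfolding carrier_sandpile_monoid_S_graph_zero[symmetric] sandpile_monoid_simps by auto
  qed
  then show ?thesis by (simp add: units sandpile_group_S_graph_zero)
qed

end
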